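(* Let $\Pi$ be a probability measure on $\mathbb{R}^d$ with density $\pi\propto\exp(-U)$, where $U\in C^2(\mathbb{R}^d)$ and $m\mathbf{I}_d\preceq\nabla^2U(x)\preceq M\mathbf{I}_d$ for all $x\in\mathbb{R}^d$, for some constants $M\ge m>0$. For each $x$ let $\lambda_1(x)\ge\dots\ge\lambda_d(x)$ be the eigenvalues of $\nabla^2U(x)$ and $v_1(x),\dots,v_d(x)$ a corresponding orthonormal basis of eigenvectors. Let $L\in GL_d(\mathbb{R})$ be symmetric positive definite with eigenvalues $\sigma_1\ge\dots\ge\sigma_d>0$ and corresponding orthonormal eigenvectors $u_1,\dots,u_d$. Suppose that there exist $\epsilon\ge0$ and $\delta\in[0,1]$ such that for all $i\in\{1,\dots,d\}$ and all $x\in\mathbb{R}^d$ \[ (1+\epsilon)^{-1}\le\frac{\lambda_i(x)}{\sigma_i^2}\le 1+\epsilon,\qquad v_i(x)^Tu_i\ge 1-\bigl(1-\sqrt{1-\delta}\bigr)^2 . \] Then the condition number $\tilde\kappa$ after preconditioning with $L$ satisfies \[ \tilde\kappa\le(1+\epsilon)^2\left(1+\delta\sqrt{\sum_{i=1}^d\sigma_i^2\sum_{i=1}^d\sigma_i^{-2}}\right)^4 . \]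
   Context: The condition number after preconditioning with $L\in GL_d(\mathbb{R})$ (that is, of the law of $LX$ when $X\sim\Pi$) is $\tilde\kappa=\sup_{x}\|L^{-T}\nabla^2U(x)L^{-1}\|\,\sup_{x}\|L\nabla^2U(x)^{-1}L^{T}\|$, with $\|\cdot\|$ the operator 2-norm. *)

theory Defs
  imports "HOL-Probability.Probability"
begin

definition gradient :: "(real ^ 'n \<Rightarrow> real) \<Rightarrow> real ^ 'n \<Rightarrow> real ^ 'n" where
  "gradient f x = (\<chi> i. frechet_derivative f (at x) (axis i 1))"

definition hessian :: "(real ^ 'n \<Rightarrow> real) \<Rightarrow> real ^ 'n \<Rightarrow> real ^ 'n ^ 'n" where
  "hessian f x = jacobian (gradient f) (at x)"

(* Continuity of f and of its gradient follows from differentiability. *)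
definition C2 :: "(real ^ 'n \<Rightarrow> real) \<Rightarrow> bool" where
  "C2 f \<longleftrightarrow>
     (\<forall>x. f differentiable (at x)) \<and>
     (\<forall>x. gradient f differentiable (at x)) \<and>
     continuous_on UNIV (hessian f)"

definition pos_semidef :: "real ^ 'n ^ 'n \<Rightarrow> bool" where
  "pos_semidef A \<longleftrightarrow> transpose A = A \<and> (\<forall>v. 0 \<le> v \<bullet> (A *v v))"

definition pos_def :: "real ^ 'n ^ 'n \<Rightarrow> bool" where
  "pos_def A \<longleftrightarrow> transpose A = A \<and> (\<forall>v. v \<noteq> 0 \<longrightarrow> 0 < v \<bullet> (A *v v))"

definition loewner_le :: "real ^ 'n ^ 'n \<Rightarrow> real ^ 'n ^ 'n \<Rightarrow> bool" (infix "\<preceq>" 50) where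
  "A \<preceq> B \<longleftrightarrow> pos_semidef (B - A)"

(* Indices run over 1..d with d = CARD('n).  The d orthonormal vectors form a basis, so
   l 1, ..., l d are all the eigenvalues of A, repeated according to multiplicity. *)
definition ordered_eigensystem ::
  "real ^ 'n ^ 'n \<Rightarrow> (nat \<Rightarrow> real) \<Rightarrow> (nat \<Rightarrow> real ^ 'n) \<Rightarrow> bool" where
  "ordered_eigensystem A l v \<longleftrightarrow>
     (\<forall>i\<in>{1..CARD('n)}. \<forall>j\<in>{1..CARD('n)}. i \<le> j \<longrightarrow> l j \<le> l i) \<and>
     (\<forall>i\<in>{1..CARD('n)}. \<forall>j\<in>{1..CARD('n)}. v i \<bullet> v j = (if i = j then 1 else 0)) \<and>
     (\<forall>i\<in>{1..CARD('n)}. A *v v i = l i *\<^sub>R v i)"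

definition op_norm :: "real ^ 'n ^ 'n \<Rightarrow> real" where
  "op_norm A = onorm (\<lambda>v. A *v v)"

(* Suprema are taken in the extended reals: in type real the supremum of an unbounded
   set is unspecified. *)
definition precond_condition_number ::
  "(real ^ 'n \<Rightarrow> real) \<Rightarrow> real ^ 'n ^ 'n \<Rightarrow> ereal" where
  "precond_condition_number U L =
     (SUP x. ereal (op_norm (matrix_inv (transpose L) ** hessian U x ** matrix_inv L))) *
     (SUP x. ereal (op_norm (L ** matrix_inv (hessian U x) ** transpose L)))"

end

theory Submission
  imports Defs
begin

text \<open>Let \<open>G\<close> have eigenvectors \<open>v i\<close> and eigenvalues \<open>\<sigma> i\<close>. Since the eigenvalues of the Hessian \<open>H\<close>
  agree with \<open>(\<sigma> i)\<^sup>2\<close> up to the factor \<open>1 + \<epsilon>\<close>, the two norms are at most \<open>1 + \<epsilon>\<close> times the squared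
  norms of \<open>G L\<^sup>-\<^sup>1\<close> and \<open>G\<^sup>-\<^sup>1 L\<close>. In the two eigenbases these have entries
  \<open>(v i \<bullet> u j) * \<sigma> i / \<sigma> j\<close> and \<open>(v i \<bullet> u j) * \<sigma> j / \<sigma> i\<close>. The diagonal parts have norm at most \<open>1\<close>;
  the alignment hypothesis forces \<open>\<bar>v i \<bullet> u j\<bar> \<le> \<delta>\<close> for \<open>i \<noteq> j\<close>, so the Frobenius norms
  of the off-diagonal parts are at most \<open>\<delta>\<close> times the square root in the bound.\<close>

section \<open>Coordinates in orthonormal eigenbases\<close>

definition orthonormal_family :: "(nat \<Rightarrow> real ^ 'n) \<Rightarrow> bool" where
  "orthonormal_family u \<longleftrightarrow>
     (\<forall>i\<in>{1..CARD('n)}. \<forall>j\<in>{1..CARD('n)}. u i \<bullet> u j = (if i = j then 1 else 0))"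

lemma orthonormal_family_inner:
  fixes u :: "nat \<Rightarrow> real ^ 'n"
  assumes "orthonormal_family u" "i \<in> {1..CARD('n)}" "j \<in> {1..CARD('n)}"
  shows "u i \<bullet> u j = (if i = j then 1 else 0)"
  using assms unfolding orthonormal_family_def by blast

text \<open>Orthonormal vectors are independent, and here there are as many as the dimension, so
  they span.\<close>

lemma orthonormal_family_expand:
  fixes u :: "nat \<Rightarrow> real ^ 'n"
  assumes u: "orthonormal_family u"
  shows "x = (\<Sum>i=1..CARD('n). (u i \<bullet> x) *\<^sub>R u i)"
proof -
  let ?I = "{1..CARD('n)}"
  let ?B = "u ` ?I"
  have inj: "inj_on u ?I"
    using orthonormal_family_inner[OF u] by (metis inj_onI zero_neq_one)
  have unit: "norm b = 1" if "b \<in> ?B" for b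
    using that orthonormal_family_inner[OF u] by (auto simp: norm_eq_1)
  have orth: "pairwise orthogonal ?B"
    using orthonormal_family_inner[OF u] by (auto simp: pairwise_def orthogonal_def)
  have "0 \<notin> ?B"
    using unit by force
  then have "independent ?B"
    using orth pairwise_orthogonal_independent by blast
  moreover have "card ?B = DIM(real ^ 'n)"
    using inj by (simp add: card_image)
  ultimately have "span ?B = UNIV"
    using card_ge_dim_independent[of ?B UNIV] by auto
  then have "x = (\<Sum>b\<in>?B. (x \<bullet> b) *\<^sub>R b)"
    using orthonormal_basis_expand[OF orth unit, of x] by simp
  also have "\<dots> = (\<Sum>i\<in>?I. (u i \<bullet> x) *\<^sub>R u i)"
    by (subst sum.reindex[OF inj]) (simp add: inner_commute)
  finally show ?thesis .
qed

lemma orthonormal_family_parseval: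
  fixes u :: "nat \<Rightarrow> real ^ 'n"
  assumes u: "orthonormal_family u"
  shows "L2_set (\<lambda>i. u i \<bullet> x) {1..CARD('n)} = norm x"
proof -
  have "x \<bullet> x = x \<bullet> (\<Sum>i=1..CARD('n). (u i \<bullet> x) *\<^sub>R u i)"
    using orthonormal_family_expand[OF u] by metis
  then show ?thesis
    by (simp add: L2_set_def norm_eq_sqrt_inner inner_sum_right power2_eq_square inner_commute)
qed

lemma inner_eigen_expand:
  fixes u :: "nat \<Rightarrow> real ^ 'n"
  assumes u: "orthonormal_family u"
    and eig: "\<And>i. i \<in> {1..CARD('n)} \<Longrightarrow> A *v u i = a i *\<^sub>R u i"
  shows "z \<bullet> (A *v x) = (\<Sum>i=1..CARD('n). a i * (u i \<bullet> z) * (u i \<bullet> x))"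
proof -
  have "A *v x = A *v (\<Sum>i=1..CARD('n). (u i \<bullet> x) *\<^sub>R u i)"
    using orthonormal_family_expand[OF u] by metis
  also have "\<dots> = (\<Sum>i=1..CARD('n). (u i \<bullet> x) *\<^sub>R (a i *\<^sub>R u i))"
    using eig by (simp add: linear_sum[OF matrix_vector_mul_linear] matrix_vector_mult_scaleR)
  finally show ?thesis
    by (simp add: inner_sum_right inner_commute mult_ac)
qed

text \<open>The expansion of the bilinear form is visibly symmetric in \<open>z\<close> and
  \<open>x\<close>. Arguing from an eigenbasis serves \<open>L\<close> and
  \<open>matrix_inv L\<close> alike, without transposing an inverse.\<close>

lemma eigen_symmetric:
  fixes u :: "nat \<Rightarrow> real ^ 'n"
  assumes "orthonormal_family u"
    and "\<And>i. i \<in> {1..CARD('n)} \<Longrightarrow> A *v u i = a i *\<^sub>R u i"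
  shows "z \<bullet> (A *v x) = (A *v z) \<bullet> x"
proof -
  have "z \<bullet> (A *v x) = x \<bullet> (A *v z)"
    using inner_eigen_expand[OF assms, of z x] inner_eigen_expand[OF assms, of x z] by (simp add: mult_ac)
  then show ?thesis
    by (simp add: inner_commute)
qed

lemma matrix_inv_eigenvector:
  fixes A :: "real ^ 'n ^ 'n"
  assumes "invertible A" "A *v w = a *\<^sub>R w" "a \<noteq> 0"
  shows "matrix_inv A *v w = inverse a *\<^sub>R w"
proof -
  \<comment> \<open>\<open>matrix_inv\<close> is a Hilbert choice; invertibility supplies the
    witness that makes its defining equations hold.\<close>
  have "A ** matrix_inv A = mat 1 \<and> matrix_inv A ** A = mat 1"
    using assms(1) unfolding matrix_inv_def invertible_def by (rule someI_ex)
  then have "matrix_inv A *v (A *v w) = w"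
    by (simp add: matrix_vector_mul_assoc)
  then have w: "a *\<^sub>R (matrix_inv A *v w) = w"
    using assms(2) by (simp add: matrix_vector_mult_scaleR)
  have "matrix_inv A *v w = inverse a *\<^sub>R (a *\<^sub>R (matrix_inv A *v w))"
    using assms(3) by simp
  then show ?thesis
    unfolding w .
qed

section \<open>Operator norm bounds\<close>

lemma op_norm_leI:
  fixes A :: "real ^ 'n ^ 'n"
  assumes "\<And>z x. z \<bullet> (A *v x) \<le> C * norm z * norm x"
  shows "op_norm A \<le> C"
  unfolding op_norm_def
proof (rule onorm_le)
  fix x :: "real ^ 'n"
  let ?y = "A *v x"
  show "norm ?y \<le> C * norm x"
  proof (cases "?y = 0")
    case True
    \<comment> \<open>The sign of \<open>C\<close> is unknown; testing the hypothesis with a unit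
      vector gives \<open>0 \<le> C * norm x\<close>.\<close>
    obtain e :: "real ^ 'n" where "norm e = 1"
      using vector_choose_size[of 1] by auto
    then show ?thesis
      using assms[of e x] True by simp
  next
    case False
    have "norm ?y * norm ?y \<le> norm ?y * (C * norm x)"
      using assms[of ?y x] by (simp add: mult_ac flip: power2_norm_eq_inner power2_eq_square)
    then show ?thesis
      using False by simp
  qed
qed

text \<open>If \<open>D\<close> has eigenvectors \<open>v i\<close> and eigenvalues
  \<open>b i\<close>, the left side is the norm of \<open>D\<^sup>-\<^sup>1 B z\<close>. The factor
  on the right adds a bound for the diagonal part to a Frobenius bound for the rest.\<close>

lemma L2_set_scaled_coordinates_le:
  fixes u v :: "nat \<Rightarrow> real ^ 'n"
  defines "I \<equiv> {1..CARD('n)}"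
  assumes u: "orthonormal_family u" and v: "orthonormal_family v"
    and eig: "\<And>i. i \<in> I \<Longrightarrow> B *v u i = b i *\<^sub>R u i"
    and pos: "\<And>i. i \<in> I \<Longrightarrow> 0 < b i"
    and off: "\<And>i j. i \<in> I \<Longrightarrow> j \<in> I \<Longrightarrow> i \<noteq> j \<Longrightarrow> \<bar>v i \<bullet> u j\<bar> \<le> \<delta>"
    and \<delta>: "0 \<le> \<delta>"
  shows "L2_set (\<lambda>i. (v i \<bullet> (B *v z)) / b i) I
    \<le> (1 + \<delta> * (L2_set b I * L2_set (\<lambda>i. inverse (b i)) I)) * norm z"
proof -
  define f where "f i j = inverse (b i) * (v i \<bullet> u j) * b j * (u j \<bullet> z)" for i j
  define K where "K = \<delta> * (L2_set b I * norm z)"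
  have split: "(v i \<bullet> (B *v z)) / b i = (v i \<bullet> u i) * (u i \<bullet> z) + (\<Sum>j\<in>I - {i}. f i j)"
    if i: "i \<in> I" for i
  proof -
    have "(v i \<bullet> (B *v z)) / b i = (\<Sum>j\<in>I. f i j)"
      using inner_eigen_expand[OF u eig, of "v i" z] unfolding I_def f_def
      by (simp add: sum_divide_distrib inner_commute field_simps)
    also have "\<dots> = f i i + (\<Sum>j\<in>I - {i}. f i j)"
      using i by (intro sum.remove) (auto simp: I_def)
    finally show ?thesis
      using pos[OF i] by (simp add: f_def)
  qed
  have diag: "L2_set (\<lambda>i. (v i \<bullet> u i) * (u i \<bullet> z)) I \<le> norm z"
  proof -
    have unit: "norm (v i) = 1 \<and> norm (u i) = 1" if "i \<in> I" for i
      using that orthonormal_family_inner[OF u] orthonormal_family_inner[OF v]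
      unfolding I_def by (simp add: norm_eq_1)
    \<comment> \<open>Absolute values are taken because monotonicity of \<open>L2_set\<close> needs
      nonnegative entries.\<close>
    have "L2_set (\<lambda>i. (v i \<bullet> u i) * (u i \<bullet> z)) I = L2_set (\<lambda>i. \<bar>v i \<bullet> u i\<bar> * \<bar>u i \<bullet> z\<bar>) I"
      by (simp add: L2_set_def power_mult_distrib)
    also have "\<dots> \<le> L2_set (\<lambda>i. \<bar>u i \<bullet> z\<bar>) I"
    proof (rule L2_set_mono)
      fix i assume "i \<in> I"
      then have "\<bar>v i \<bullet> u i\<bar> \<le> 1"
        using unit Cauchy_Schwarz_ineq2[of "v i" "u i"] by simp
      then show "\<bar>v i \<bullet> u i\<bar> * \<bar>u i \<bullet> z\<bar> \<le> \<bar>u i \<bullet> z\<bar>"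
        by (simp add: mult_left_le_one_le)
    qed simp
    also have "\<dots> = norm z"
      using orthonormal_family_parseval[OF u, of z] unfolding I_def by (simp add: L2_set_def)
    finally show ?thesis .
  qed
  \<comment> \<open>Cauchy-Schwarz in \<open>j\<close> leaves a bound that depends on
    \<open>i\<close> only through \<open>inverse (b i)\<close>, so \<open>L2_set\<close> over
    \<open>i\<close> then yields the second factor.\<close>
  have off_row: "\<bar>\<Sum>j\<in>I - {i}. f i j\<bar> \<le> inverse (b i) * K" if i: "i \<in> I" for i
  proof -
    have "\<bar>\<Sum>j\<in>I - {i}. f i j\<bar> \<le> (\<Sum>j\<in>I - {i}. \<bar>f i j\<bar>)"
      by (rule sum_abs)
    also have "\<dots> \<le> (\<Sum>j\<in>I - {i}. inverse (b i) * (\<delta> * (\<bar>b j\<bar> * \<bar>u j \<bullet> z\<bar>)))"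
    proof (rule sum_mono)
      fix j assume j: "j \<in> I - {i}"
      have "\<bar>f i j\<bar> = inverse (b i) * (\<bar>v i \<bullet> u j\<bar> * (\<bar>b j\<bar> * \<bar>u j \<bullet> z\<bar>))"
        using pos[OF i] by (simp add: f_def abs_mult)
      also have "\<dots> \<le> inverse (b i) * (\<delta> * (\<bar>b j\<bar> * \<bar>u j \<bullet> z\<bar>))"
        using off[of i j] i j pos[OF i] by (intro mult_left_mono mult_right_mono) auto
      finally show "\<bar>f i j\<bar> \<le> \<dots>" .
    qed
    \<comment> \<open>Restoring the term \<open>j = i\<close> only enlarges the sum and makes
      Parseval applicable.\<close>
    also have "\<dots> \<le> (\<Sum>j\<in>I. inverse (b i) * (\<delta> * (\<bar>b j\<bar> * \<bar>u j \<bullet> z\<bar>)))"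
      using pos[OF i] \<delta> by (intro sum_mono2) (auto simp: I_def)
    also have "\<dots> = inverse (b i) * (\<delta> * (\<Sum>j\<in>I. \<bar>b j\<bar> * \<bar>u j \<bullet> z\<bar>))"
      by (simp add: sum_distrib_left)
    also have "\<dots> \<le> inverse (b i) * K"
      unfolding K_def using pos[OF i] \<delta> L2_set_mult_ineq[of b "\<lambda>j. u j \<bullet> z" I]
        orthonormal_family_parseval[OF u, of z]
      by (intro mult_left_mono) (auto simp: I_def)
    finally show ?thesis .
  qed
  have "L2_set (\<lambda>i. (v i \<bullet> (B *v z)) / b i) I
    = L2_set (\<lambda>i. (v i \<bullet> u i) * (u i \<bullet> z) + (\<Sum>j\<in>I - {i}. f i j)) I"
    by (rule L2_set_cong) (simp_all add: split)
  also have "\<dots> \<le> L2_set (\<lambda>i. (v i \<bullet> u i) * (u i \<bullet> z)) I + L2_set (\<lambda>i. \<Sum>j\<in>I - {i}. f i j) I"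
    by (rule L2_set_triangle_ineq)
  also have "L2_set (\<lambda>i. \<Sum>j\<in>I - {i}. f i j) I = L2_set (\<lambda>i. \<bar>\<Sum>j\<in>I - {i}. f i j\<bar>) I"
    by (simp add: L2_set_def)
  also have "\<dots> \<le> L2_set (\<lambda>i. inverse (b i) * K) I"
    by (rule L2_set_mono) (use off_row in auto)
  also have "\<dots> = L2_set (\<lambda>i. inverse (b i)) I * K"
    using \<delta> by (simp add: L2_set_left_distrib K_def L2_set_nonneg)
  finally show ?thesis
    using diag by (simp add: K_def algebra_simps)
qed

text \<open>Moving the self-adjoint \<open>B\<close> across the inner product and expanding in the
  eigenbasis of \<open>A\<close>, the bound on \<open>a i\<close> supplies the division by
  \<open>b i\<close> in each of the two coordinates. Both norms have this shape: \<open>B\<close> is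
  the inverse of \<open>L\<close> around the Hessian, or \<open>L\<close> around the inverse
  Hessian.\<close>

lemma op_norm_sandwich_le:
  fixes u v :: "nat \<Rightarrow> real ^ 'n"
  defines "I \<equiv> {1..CARD('n)}"
  assumes u: "orthonormal_family u" and v: "orthonormal_family v"
    and eigB: "\<And>i. i \<in> I \<Longrightarrow> B *v u i = b i *\<^sub>R u i"
    and pos: "\<And>i. i \<in> I \<Longrightarrow> 0 < b i"
    and off: "\<And>i j. i \<in> I \<Longrightarrow> j \<in> I \<Longrightarrow> i \<noteq> j \<Longrightarrow> \<bar>v i \<bullet> u j\<bar> \<le> \<delta>"
    and \<delta>: "0 \<le> \<delta>"
    and eigA: "\<And>i. i \<in> I \<Longrightarrow> A *v v i = a i *\<^sub>R v i"
    and a: "\<And>i. i \<in> I \<Longrightarrow> 0 \<le> a i" "\<And>i. i \<in> I \<Longrightarrow> a i \<le> C / (b i)\<^sup>2"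
    and C: "0 \<le> C"
  shows "op_norm (B ** A ** B) \<le> C * (1 + \<delta> * (L2_set b I * L2_set (\<lambda>i. inverse (b i)) I))\<^sup>2"
proof (rule op_norm_leI)
  fix z x :: "real ^ 'n"
  define K where "K = 1 + \<delta> * (L2_set b I * L2_set (\<lambda>i. inverse (b i)) I)"
  have K: "0 \<le> K"
    unfolding K_def using \<delta> by (intro add_nonneg_nonneg mult_nonneg_nonneg) auto
  define g where "g y i = (v i \<bullet> (B *v y)) / b i" for y i
  have g: "L2_set (g y) I \<le> K * norm y" for y
    unfolding g_def K_def I_def
    using u v eigB pos off \<delta> unfolding I_def by (rule L2_set_scaled_coordinates_le)
  have "z \<bullet> ((B ** A ** B) *v x) = (B *v z) \<bullet> (A *v (B *v x))"
    using eigen_symmetric[OF u eigB, of z] by (simp add: I_def flip: matrix_vector_mul_assoc)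
  also have "\<dots> = (\<Sum>i\<in>I. a i * (v i \<bullet> (B *v z)) * (v i \<bullet> (B *v x)))"
    using inner_eigen_expand[OF v eigA] unfolding I_def by simp
  also have "\<dots> \<le> (\<Sum>i\<in>I. C * (\<bar>g z i\<bar> * \<bar>g x i\<bar>))"
  proof (rule sum_mono)
    fix i assume i: "i \<in> I"
    have "a i * (v i \<bullet> (B *v z)) * (v i \<bullet> (B *v x)) \<le> \<bar>a i * (v i \<bullet> (B *v z)) * (v i \<bullet> (B *v x))\<bar>"
      by simp
    also have "\<dots> = a i * (\<bar>v i \<bullet> (B *v z)\<bar> * \<bar>v i \<bullet> (B *v x)\<bar>)"
      using a(1)[OF i] by (simp add: abs_mult)
    also have "\<dots> \<le> C / (b i)\<^sup>2 * (\<bar>v i \<bullet> (B *v z)\<bar> * \<bar>v i \<bullet> (B *v x)\<bar>)"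
      using a(2)[OF i] by (intro mult_right_mono) auto
    also have "\<dots> = C * (\<bar>g z i\<bar> * \<bar>g x i\<bar>)"
      using pos[OF i] by (simp add: g_def power2_eq_square)
    finally show "a i * (v i \<bullet> (B *v z)) * (v i \<bullet> (B *v x)) \<le> \<dots>" .
  qed
  also have "\<dots> \<le> C * (L2_set (g z) I * L2_set (g x) I)"
    using C L2_set_mult_ineq[of "g z" "g x" I] by (simp add: mult_left_mono flip: sum_distrib_left)
  also have "\<dots> \<le> C * ((K * norm z) * (K * norm x))"
    using C g K by (intro mult_left_mono mult_mono) auto
  finally show "z \<bullet> ((B ** A ** B) *v x) \<le> C * K\<^sup>2 * norm z * norm x"
    by (simp add: power2_eq_square mult_ac)
qed

section \<open>Consequences of the alignment and of the lower Loewner bound\<close>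

text \<open>Writing \<open>t = 1 - sqrt (1 - \<delta>)\<close>, one has \<open>\<delta> = t * (2 - t)\<close>, and Parseval bounds the squared
  inner product by \<open>1 - (1 - t\<^sup>2)\<^sup>2 = t\<^sup>2 * (2 - t\<^sup>2) \<le> t\<^sup>2 * (2 - t)\<^sup>2\<close>.\<close>

lemma aligned_off_diagonal_le:
  fixes u v :: "nat \<Rightarrow> real ^ 'n"
  assumes u: "orthonormal_family u" and v: "orthonormal_family v"
    and \<delta>: "\<delta> \<in> {0..1}"
    and ij: "i \<in> {1..CARD('n)}" "j \<in> {1..CARD('n)}" "i \<noteq> j"
    and al: "v i \<bullet> u i \<ge> 1 - (1 - sqrt (1 - \<delta>))\<^sup>2"
  shows "\<bar>v i \<bullet> u j\<bar> \<le> \<delta>"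
proof -
  define t where "t = 1 - sqrt (1 - \<delta>)"
  have t: "0 \<le> t" "t \<le> 1" "\<delta> = t * (2 - t)"
    using \<delta> by (auto simp: t_def algebra_simps simp flip: power2_eq_square)
  \<comment> \<open>Nonnegativity of the lower bound allows squaring the alignment
    inequality.\<close>
  have "0 \<le> 1 - t\<^sup>2"
    using t by (simp add: power_le_one)
  then have diag: "(1 - t\<^sup>2)\<^sup>2 \<le> (v i \<bullet> u i)\<^sup>2"
    using al unfolding t_def by (intro power_mono)
  have "(u i \<bullet> v i)\<^sup>2 + (u j \<bullet> v i)\<^sup>2 = (\<Sum>k\<in>{i, j}. (u k \<bullet> v i)\<^sup>2)"
    using ij(3) by simp
  also have "\<dots> \<le> (\<Sum>k=1..CARD('n). (u k \<bullet> v i)\<^sup>2)"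
    using ij by (intro sum_mono2) auto
  also have "\<dots> = (norm (v i))\<^sup>2"
    unfolding orthonormal_family_parseval[OF u, symmetric] L2_set_def by (simp add: sum_nonneg)
  also have "\<dots> = 1"
    using orthonormal_family_inner[OF v ij(1) ij(1)] by (simp add: power2_norm_eq_inner)
  finally have "(v i \<bullet> u j)\<^sup>2 \<le> 1 - (1 - t\<^sup>2)\<^sup>2"
    using diag by (simp add: inner_commute)
  \<comment> \<open>The slack is an explicit square, from
    \<open>(2 - t)\<^sup>2 - (2 - t\<^sup>2) = 2 * (1 - t)\<^sup>2\<close>.\<close>
  also have "\<dots> = \<delta>\<^sup>2 - 2 * (t * (1 - t))\<^sup>2"
    unfolding t(3) by (simp add: power2_eq_square algebra_simps)
  also have "\<dots> \<le> \<delta>\<^sup>2"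
    by simp
  finally show ?thesis
    using \<delta> by (simp add: abs_le_square_iff flip: power2_le_iff_abs_le)
qed

text \<open>A kernel vector \<open>x\<close> would satisfy
  \<open>m * (x \<bullet> x) \<le> 0\<close>. Invertibility gives \<open>matrix_inv\<close> of the
  Hessian its meaning.\<close>

lemma invertible_loewner_ge:
  fixes A :: "real ^ 'n ^ 'n"
  assumes "0 < m" "m *\<^sub>R mat 1 \<preceq> A"
  shows "invertible A"
proof -
  have "x = 0" if "A *v x = 0" for x
  proof -
    have "0 \<le> x \<bullet> ((A - m *\<^sub>R mat 1) *v x)"
      using assms(2) by (simp add: loewner_le_def pos_semidef_def)
    then have le: "m * (x \<bullet> x) \<le> 0"
      using that by (simp add: matrix_vector_mult_diff_rdistrib scaleR_matrix_vector_assoc[symmetric] inner_diff_right)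
    show ?thesis
    proof (rule ccontr)
      assume "x \<noteq> 0"
      then have "0 < m * (x \<bullet> x)"
        using assms(1) by simp
      then show False
        using le by simp
    qed
  qed
  then show ?thesis
    by (metis invertible_left_inverse matrix_left_invertible_ker)
qed

section \<open>Bounding the two suprema\<close>

theorem theorem3:
  fixes P :: "(real ^ 'n) measure"
    and U :: "real ^ 'n \<Rightarrow> real"
    and m M \<epsilon> \<delta> :: real
    and lam :: "real ^ 'n \<Rightarrow> nat \<Rightarrow> real"
    and v :: "real ^ 'n \<Rightarrow> nat \<Rightarrow> real ^ 'n"
    and L :: "real ^ 'n ^ 'n"
    and \<sigma> :: "nat \<Rightarrow> real"
    and u :: "nat \<Rightarrow> real ^ 'n"
  assumes "prob_space P"
    and "\<exists>c>0. P = density lborel (\<lambda>x. ennreal (c * exp (- U x)))"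
    and "C2 U"
    and "0 < m" and "m \<le> M"
    and "\<And>x. m *\<^sub>R mat 1 \<preceq> hessian U x"
    and "\<And>x. hessian U x \<preceq> M *\<^sub>R mat 1"
    and "\<And>x. ordered_eigensystem (hessian U x) (lam x) (v x)"
    and "invertible L" and "pos_def L"
    and "ordered_eigensystem L \<sigma> u"
    and "\<And>i. i \<in> {1..CARD('n)} \<Longrightarrow> 0 < \<sigma> i"
    and "0 \<le> \<epsilon>" and "\<delta> \<in> {0..1}"
    and "\<And>i x. i \<in> {1..CARD('n)} \<Longrightarrow>
           inverse (1 + \<epsilon>) \<le> lam x i / (\<sigma> i)\<^sup>2 \<and> lam x i / (\<sigma> i)\<^sup>2 \<le> 1 + \<epsilon>"
    and "\<And>i x. i \<in> {1..CARD('n)} \<Longrightarrow>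
           v x i \<bullet> u i \<ge> 1 - (1 - sqrt (1 - \<delta>))\<^sup>2"
  shows "precond_condition_number U L \<le>
    ereal ((1 + \<epsilon>)\<^sup>2 *
      (1 + \<delta> * sqrt ((\<Sum>i=1..CARD('n). (\<sigma> i)\<^sup>2) * (\<Sum>i=1..CARD('n). inverse ((\<sigma> i)\<^sup>2)))) ^ 4)"
proof -
  let ?I = "{1..CARD('n)}"
  let ?H = "hessian U"
  define K where "K = 1 + \<delta> * sqrt ((\<Sum>i\<in>?I. (\<sigma> i)\<^sup>2) * (\<Sum>i\<in>?I. inverse ((\<sigma> i)\<^sup>2)))"
  have K_L2: "K = 1 + \<delta> * (L2_set \<sigma> ?I * L2_set (\<lambda>i. inverse (\<sigma> i)) ?I)"
    by (simp add: K_def L2_set_def real_sqrt_mult power_inverse)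
  note \<sigma> = assms(12) and \<epsilon> = assms(13) and \<delta> = assms(14)
  have u: "orthonormal_family u" and eigL: "\<And>i. i \<in> ?I \<Longrightarrow> L *v u i = \<sigma> i *\<^sub>R u i"
    using assms(11) by (auto simp: ordered_eigensystem_def orthonormal_family_def)
  have v: "orthonormal_family (v x)" and eigH: "\<And>i. i \<in> ?I \<Longrightarrow> ?H x *v v x i = lam x i *\<^sub>R v x i" for x
    using assms(8)[of x] by (auto simp: ordered_eigensystem_def orthonormal_family_def)
  have off: "\<bar>v x i \<bullet> u j\<bar> \<le> \<delta>" if "i \<in> ?I" "j \<in> ?I" "i \<noteq> j" for x i j
    using aligned_off_diagonal_le[OF u v \<delta> that] assms(16) that by blast
  have lam_ge: "(\<sigma> i)\<^sup>2 / (1 + \<epsilon>) \<le> lam x i" and lam_le: "lam x i \<le> (1 + \<epsilon>) * (\<sigma> i)\<^sup>2"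
    if "i \<in> ?I" for x i
    using assms(15)[OF that, of x] \<sigma>[OF that] \<epsilon> by (auto simp: field_simps)
  have lam_pos: "0 < lam x i" if "i \<in> ?I" for x i
    using lam_ge[OF that, of x] \<sigma>[OF that] \<epsilon>
    by (meson add_pos_nonneg divide_pos_pos less_le_trans zero_less_one zero_less_power)
  have LT: "transpose L = L"
    using assms(10) by (simp add: pos_def_def)
  have first: "op_norm (matrix_inv (transpose L) ** ?H x ** matrix_inv L) \<le> (1 + \<epsilon>) * K\<^sup>2" for x
  proof -
    \<comment> \<open>Here the eigenvalues \<open>b i\<close> are the reciprocals of
      \<open>\<sigma> i\<close>, and \<open>C\<close> is \<open>1 + \<epsilon>\<close>.\<close>
    have "op_norm (matrix_inv L ** ?H x ** matrix_inv L)
      \<le> (1 + \<epsilon>) * (1 + \<delta> * (L2_set (\<lambda>i. inverse (\<sigma> i)) ?I * L2_set (\<lambda>i. inverse (inverse (\<sigma> i))) ?I))\<^sup>2"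
    proof (rule op_norm_sandwich_le[OF u v[of x]])
      show "matrix_inv L *v u i = inverse (\<sigma> i) *\<^sub>R u i" if "i \<in> ?I" for i
        using matrix_inv_eigenvector[OF assms(9) eigL[OF that]] \<sigma>[OF that] by simp
      show "lam x i \<le> (1 + \<epsilon>) / (inverse (\<sigma> i))\<^sup>2" if "i \<in> ?I" for i
        using lam_le[OF that, of x] by (simp add: divide_inverse power_inverse)
    qed (use \<sigma> \<epsilon> \<delta> off eigH lam_pos in \<open>auto simp: less_imp_le\<close>)
    \<comment> \<open>Replacing \<open>\<sigma>\<close> by its reciprocal merely swaps the two
      \<open>L2_set\<close> factors, so \<open>K\<close> is the same for both norms.\<close>
    then show ?thesis
      unfolding LT K_L2 by (simp add: mult.commute)
  qed
  have second: "op_norm (L ** matrix_inv (?H x) ** transpose L) \<le> (1 + \<epsilon>) * K\<^sup>2" for x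
    unfolding LT K_L2
  proof (rule op_norm_sandwich_le[OF u v[of x]])
    have "invertible (?H x)"
      using assms(4,6) by (rule invertible_loewner_ge)
    then show "matrix_inv (?H x) *v v x i = inverse (lam x i) *\<^sub>R v x i" if "i \<in> ?I" for i
      using matrix_inv_eigenvector[OF _ eigH[OF that]] lam_pos[OF that, of x] by simp
    show "inverse (lam x i) \<le> (1 + \<epsilon>) / (\<sigma> i)\<^sup>2" if "i \<in> ?I" for i
      using lam_ge[OF that, of x] lam_pos[OF that, of x] \<sigma>[OF that] \<epsilon> by (simp add: field_simps)
  qed (use \<sigma> \<epsilon> \<delta> off eigL lam_pos in \<open>auto simp: less_imp_le\<close>)
  \<comment> \<open>Multiplying the two bounds in \<open>ereal\<close> needs the second supremum to
    be nonnegative.\<close>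
  have "0 \<le> op_norm A" for A :: "real ^ 'n ^ 'n"
    unfolding op_norm_def by (simp add: onorm_pos_le)
  then have "0 \<le> (SUP x. ereal (op_norm (L ** matrix_inv (?H x) ** transpose L)))"
    by (meson SUP_upper2 UNIV_I ereal_less_eq(5))
  then have "precond_condition_number U L \<le> ereal ((1 + \<epsilon>) * K\<^sup>2) * ereal ((1 + \<epsilon>) * K\<^sup>2)"
    unfolding precond_condition_number_def using first second \<epsilon>
    by (intro ereal_mult_mono SUP_least) auto
  also have "\<dots> = ereal ((1 + \<epsilon>)\<^sup>2 * K ^ 4)"
    by (simp add: power2_eq_square power4_eq_xxxx mult_ac)
  finally show ?thesis
    unfolding K_def .
qed

end
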